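(* Let $n$ be a positive integer such that $5\mid 2n^2+2n+1$, $8n+1$ is not a perfect square, and $8n-3\neq 5k^2$ for all $k\in\mathbb{Z}$. Let $m=(2n^2+2n+1)/5$ and let $C_5$ be the cyclic group of order $5$. Then there is no element $\overline{T}=\sum_{g\in C_5}a_g g\in\mathbb{Z}[C_5]$ with nonnegative integer coefficients and $\sum_g a_g=2n+1$ (i.e. a multiset of $2n+1$ elements of $C_5$) satisfying both (b') $\overline{T}=\overline{T}^{(-1)}$, and (c') $\overline{T}^2=2mC_5-\overline{T}^{(2)}+2n$ in $\mathbb{Z}[C_5]$.
   Context: In the group ring $\mathbb{Z}[C_5]$, $C_5$ denotes $\sum_{g\in C_5}g$, an integer $k$ denotes $k$ times the identity, and for $A=\sum_g a_g g$ and an integer $t$, $A^{(t)}=\sum_g a_g g^t$. *)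

theory Defs
  imports "HOL-Library.Poly_Mapping" "HOL-Library.Numeral_Type"
begin

text \<open>
  The cyclic group of order 5 is the additive group of the type \<^typ>\<open>5\<close> of integers modulo 5.
  The group is written additively here and multiplicatively in the usual notation for group rings,
  so the identity of the group is 0 and the power \<open>g\<^sup>t\<close> is \<^term>\<open>of_int t * g\<close>.
  Multiplication on \<^typ>\<open>5 \<Rightarrow>\<^sub>0 int\<close> is convolution over this additive group, its unit is
  \<^term>\<open>Poly_Mapping.single 0 1\<close>, and an integer \<open>k\<close> stands for \<^term>\<open>of_int k :: 5 \<Rightarrow>\<^sub>0 int\<close>.
\<close>

type_synonym zc5 = "5 \<Rightarrow>\<^sub>0 int"

definition C5 :: zc5 where
  "C5 = (\<Sum>g\<in>UNIV. Poly_Mapping.single g 1)"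

definition group_pow :: "zc5 \<Rightarrow> int \<Rightarrow> zc5" where
  "group_pow A t = (\<Sum>g\<in>UNIV. Poly_Mapping.single (of_int t * g) (Poly_Mapping.lookup A g))"

end

theory Submission
  imports Defs
begin

text \<open>
  By (b'), \<open>T = a + b (g + g\<^sup>-\<^sup>1) + c (g\<^sup>2 + g\<^sup>-\<^sup>2)\<close>. Comparing the coefficients of \<open>g\<close> and
  \<open>g\<^sup>2\<close> in (c') gives \<open>(b - c) (2 a - b - c - 1) = 0\<close>. If \<open>b = c\<close>, the coefficients of \<open>1\<close> and
  \<open>g\<close> give \<open>8 n + 1 = (2 (a - b) + 1)\<^sup>2\<close>; otherwise \<open>2 a = b + c + 1\<close> and the three coefficients
  combine to \<open>8 n - 3 = 5 (b - c)\<^sup>2\<close>.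
\<close>

text \<open>Since \<open>k = i + j\<close> determines \<open>j\<close>, the convolution collapses to
  a single sum over the group.\<close>

lemma lookup_mult_finite_group:
  fixes A B :: "'a::{finite, ab_group_add} \<Rightarrow>\<^sub>0 'b::semiring_0"
  shows "Poly_Mapping.lookup (A * B) k =
    (\<Sum>i\<in>UNIV. Poly_Mapping.lookup A i * Poly_Mapping.lookup B (k - i))"
proof -
  have "k = i + j \<longleftrightarrow> j = k - i" for i j :: 'a
    by (auto simp: algebra_simps)
  then show ?thesis
    by (simp add: lookup_mult Sum_any.expand_superset[of UNIV] when_def)
qed

lemma UNIV_5: "(UNIV :: 5 set) = {0, 1, 2, 3, 4}"
  by (rule sym, rule card_subset_eq) simp_all

text \<open>
  \<open>UNIV_5\<close> loops as a simp rule, since numerals of type \<open>5\<close> are compared through the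
  cardinality of \<open>UNIV\<close>.
\<close>
lemma sum_UNIV_5: "sum f (UNIV :: 5 set) = f 0 + f 1 + f 2 + f 3 + f 4"
  for f :: "5 \<Rightarrow> 'a::comm_monoid_add"
  unfolding UNIV_5 by (simp add: add.assoc)

lemma lookup_C5: "Poly_Mapping.lookup C5 g = 1"
  by (simp add: C5_def lookup_sum lookup_single when_def)

lemma lookup_group_pow:
  "Poly_Mapping.lookup (group_pow A t) k =
    (\<Sum>g\<in>UNIV. if of_int t * g = k then Poly_Mapping.lookup A g else 0)"
  by (simp add: group_pow_def lookup_sum lookup_single when_def)

lemma lookup_group_pow_minus_1:
  "Poly_Mapping.lookup (group_pow A (-1)) k = Poly_Mapping.lookup A (- k)"
proof -
  have "- g = k \<longleftrightarrow> g = - k" for g :: 5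
    by auto
  then show ?thesis
    by (simp add: lookup_group_pow)
qed

text \<open>Squaring permutes the group, as 2 is invertible modulo 5 with inverse 3.\<close>

lemma lookup_group_pow_2:
  "Poly_Mapping.lookup (group_pow A 2) k = Poly_Mapping.lookup A (3 * k)"
proof -
  have "3 * 2 = (1::5)" "2 * 3 = (1::5)"
    by simp_all
  then have "3 * (2 * g) = g" "2 * (3 * g) = g" for g :: 5
    by (simp_all only: mult.assoc[symmetric] mult_1_left)
  then have "2 * g = k \<longleftrightarrow> g = 3 * k" for g :: 5
    by metis
  then show ?thesis
    by (simp add: lookup_group_pow)
qed

lemma lookup_of_nat_mult_C5: "Poly_Mapping.lookup (of_nat k * C5) g = int k"
  by (simp add: lookup_mult_finite_group lookup_C5 lookup_of_nat when_def)

theorem theorem4: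
  fixes n m :: nat
  assumes "n > 0"
    and "5 dvd 2 * n^2 + 2 * n + 1"
    and "\<nexists>k::nat. 8 * n + 1 = k^2"
    and "\<forall>k::int. 8 * int n - 3 \<noteq> 5 * k^2"
    and "m = (2 * n^2 + 2 * n + 1) div 5"
  shows "\<nexists>T :: zc5.
    (\<forall>g. Poly_Mapping.lookup T g \<ge> 0) \<and>
    (\<Sum>g\<in>UNIV. Poly_Mapping.lookup T g) = 2 * int n + 1 \<and>
    T = group_pow T (-1) \<and>
    T^2 = of_nat (2 * m) * C5 - group_pow T 2 + of_nat (2 * n)"
proof (rule notI, elim exE conjE)
  fix T :: zc5
  assume b': "T = group_pow T (-1)"
    and c': "T^2 = of_nat (2 * m) * C5 - group_pow T 2 + of_nat (2 * n)"
  define a b c where "a = Poly_Mapping.lookup T 0" and "b = Poly_Mapping.lookup T 1"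
    and "c = Poly_Mapping.lookup T 2"
  \<comment> \<open>Negatives arise from the differences \<open>k - i\<close> of the convolution,
    and 6 is \<open>3 * k\<close> at \<open>k = 2\<close>.\<close>
  have mod_5: "- 1 = (4::5)" "- 2 = (3::5)" "- 3 = (2::5)" "- 4 = (1::5)" "6 = (1::5)" "8 = (3::5)"
    by simp_all
  have T_minus: "Poly_Mapping.lookup T k = Poly_Mapping.lookup T (- k)" for k
    by (subst b') (rule lookup_group_pow_minus_1)
  have T4: "Poly_Mapping.lookup T 4 = b"
    using T_minus[of 4] by (simp add: b_def mod_5)
  have T3: "Poly_Mapping.lookup T 3 = c"
    using T_minus[of 3] by (simp add: c_def mod_5)
  note coeffs = a_def[symmetric] b_def[symmetric] c_def[symmetric] T3 T4
  have sq: "Poly_Mapping.lookup (T * T) k =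
      2 * int m - Poly_Mapping.lookup (group_pow T 2) k + (if k = 0 then 2 * int n else 0)" for k
    using arg_cong[OF c', of "\<lambda>A. Poly_Mapping.lookup A k"]
    by (simp add: power2_eq_square lookup_add lookup_minus lookup_of_nat_mult_C5 lookup_of_nat when_def
        del: of_nat_mult)
  have E0: "a^2 + 2 * b^2 + 2 * c^2 = 2 * int m - a + 2 * int n"
    using sq[of 0]
    by (simp add: lookup_mult_finite_group lookup_group_pow_2 sum_UNIV_5 mod_5 coeffs power2_eq_square algebra_simps)
  have E1: "2 * a * b + 2 * b * c + c^2 = 2 * int m - c"
    using sq[of 1]
    by (simp add: lookup_mult_finite_group lookup_group_pow_2 sum_UNIV_5 mod_5 coeffs power2_eq_square algebra_simps)
  have E2: "2 * a * c + b^2 + 2 * b * c = 2 * int m - b"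
    using sq[of 2]
    by (simp add: lookup_mult_finite_group lookup_group_pow_2 sum_UNIV_5 mod_5 coeffs power2_eq_square algebra_simps)
  have "(b - c) * (2 * a - b - c - 1) = 0"
    using E1 E2 by (simp add: algebra_simps power2_eq_square)
  then consider "b = c" | "b + c = 2 * a - 1"
    by fastforce
  then show False
  proof cases
    case 1
    \<comment> \<open>Subtracting \<open>E1\<close> from \<open>E0\<close> leaves
      \<open>(a - b)^2 + (a - b) = 2 * n\<close>; complete the square.\<close>
    have "int (8 * n + 1) = (2 * (a - b) + 1)^2"
      using E0 E1 1 by (simp add: algebra_simps power2_eq_square)
    \<comment> \<open>The non-square hypothesis ranges over naturals, hence the absolute
      value.\<close>
    also have "\<dots> = int ((nat \<bar>2 * (a - b) + 1\<bar>)^2)"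
      by simp
    finally show False
      using assms(3) by (metis of_nat_eq_iff)
  next
    case 2
    then have c: "c = 2 * a - 1 - b"
      by simp
    \<comment> \<open>Four times \<open>E0\<close> minus twice \<open>E1\<close> and twice
      \<open>E2\<close> eliminates \<open>m\<close>; with \<open>b + c = 2 * a - 1\<close> only
      \<open>b - c\<close> and \<open>n\<close> remain.\<close>
    have "8 * int n - 3 = 5 * (b - c)^2"
      using E0 E1 E2 unfolding c by (simp add: algebra_simps power2_eq_square)
    then show False
      using assms(4) by blast
  qed
qed

end
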